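(* Let $f$ satisfy the standing assumptions of the context, and let $\{\mathbf z_k^+\}$ be generated by the ZOCEG algorithm (defined in the context) with step size $\eta$ satisfying $0<\eta L\le\frac12$, smoothing radii $r_k>0$ satisfying $\sum_{k=0}^\infty r_k\le\frac{M_3}{\sqrt{d_x}+\sqrt{d_y}}<\infty$ for some $M_3>0$, and initial point $\mathbf z_0\in\mathcal Z$. Let $\epsilon>0$. Then for any integer $K>1$ with $$K\ge\max\left\{\frac{\tilde D^2}{\eta\epsilon},\ \frac{3LM_3\tilde D}{\epsilon}\right\},$$ the averaged iterate $\hat{\mathbf z}_K=(\hat{\mathbf x}_K,\hat{\mathbf y}_K)=\frac1K\sum_{k=0}^{K-1}\mathbf z_k^+$ satisfies $$\Delta(\hat{\mathbf z}_K)\le\epsilon .$$ Moreover, for $f(\mathbf x,\mathbf y)=\phi_0(\mathbf x)+\sum_{j=1}^{d_y}y_j\phi_j(\mathbf x)$ the Lagrangian of the constrained problem $\min_{\mathbf x\in\mathcal X}\phi_0(\mathbf x)$ s.t. $\phi_j(\mathbf x)\le0$, $j=1,\dots,d_y$ (with the conventions for the Lagrangian case in the context), $$\|[\boldsymbol\phi(\hat{\mathbf x}_K)]_+\|\le\frac{\epsilon}{R},\qquad \phi_0(\hat{\mathbf x}_K)-\phi_0^*\le\epsilon .$$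
   Context: Notation: $\|\cdot\|$ is the Euclidean norm; $[\cdot]_+$ is the componentwise maximum with $0$; $\mathcal P_{\mathcal S}$ is the Euclidean projection onto a closed convex set $\mathcal S$; $\mathbf e_i$ denotes the $i$-th standard basis vector (of $\mathbb R^{d_x}$ or $\mathbb R^{d_y}$ as appropriate); $d_x,d_y\ge 1$, $\mathbf z=(\mathbf x,\mathbf y)\in\mathbb R^{d_x}\times\mathbb R^{d_y}$. Standing assumptions: $\mathcal X\subset\mathbb R^{d_x}$ and $\mathcal Y\subset\mathbb R^{d_y}$ are compact and convex; $\mathcal Z=\mathcal X\times\mathcal Y$; $\tilde D=\max_{\mathbf z,\mathbf z'\in\mathcal Z}\|\mathbf z-\mathbf z'\|$. The function $f:\mathbb R^{d_x}\times\mathbb R^{d_y}\to\mathbb R$ is continuously differentiable over $\mathcal X\times\mathcal Y$, convex in $\mathbf x$ and concave in $\mathbf y$; and for all $\mathbf z_1,\mathbf z_2\in\mathcal Z$, $|f(\mathbf z_1)-f(\mathbf z_2)|\le G\|\mathbf z_1-\mathbf z_2\|$ and $\|\nabla f(\mathbf z_1)-\nabla f(\mathbf z_2)\|\le L\|\mathbf z_1-\mathbf z_2\|$. A saddle point $\mathbf z^*=(\mathbf x^*,\mathbf y^* )\in\mathcal Z$ of $f$, i.e. $f(\mathbf x^*,\mathbf y)\le f(\mathbf x^*,\mathbf y^* )\le f(\mathbf x,\mathbf y^* )$ for all $(\mathbf x,\mathbf y)\in\mathcal Z$, is assumed to exist and is fixed. The duality gap of $\mathbf z=(\mathbf x,\mathbf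 y)\in\mathcal Z$ is $\Delta(\mathbf z)=f(\mathbf x,\mathbf y^* )-f(\mathbf x^*,\mathbf y)$. Lagrangian case: the functions $\phi_j:\mathbb R^{d_x}\to\mathbb R$, $j=0,\dots,d_y$, are convex; $\boldsymbol\phi=(\phi_1,\dots,\phi_{d_y})^T$; the compact convex set $\mathcal Y$ contains $\mathbf y^*$ and is used in place of the unbounded multiplier set $\{\mathbf y\in\mathbb R^{d_y}:\mathbf y\ge0\}$; $\phi_0^*=\phi_0(\mathbf x^* )$ denotes the optimal objective value of the constrained problem; $R=\max\{r>0:\mathbf y^*+r\mathbf u\in\mathcal Y\text{ for all }\mathbf u\in\mathbb R^{d_y}\text{ with }\|\mathbf u\|=1\}$. ZOCEG algorithm (deterministic): for $r>0$ put $$\hat{\mathbf g}^x(\mathbf x,\mathbf y;r)=\sum_{i=1}^{d_x}\frac{f(\mathbf x+r\mathbf e_i,\mathbf y)-f(\mathbf x,\mathbf y)}{r}\mathbf e_i,\qquad \hat{\mathbf g}^y(\mathbf x,\mathbf y;r)=\sum_{j=1}^{d_y}\frac{f(\mathbf x,\mathbf y+r\mathbf e_j)-f(\mathbf x,\mathbf y)}{r}\mathbf e_j .$$ For $k=0,1,2,\dots$: $$\mathbf x_k^+=\mathcal P_{\mathcal X}[\mathbf x_k-\eta\,\hat{\mathbf g}^x(\mathbf x_k,\mathbf y_k;r_k)],\quad \mathbf y_k^+=\mathcal P_{\mathcal Y}[\mathbf y_k+\eta\,\hat{\mathbf g}^y(\mathbf x_k,\mathbf y_k;r_k)],$$ $$\mathbf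 x_{k+1}=\mathcal P_{\mathcal X}[\mathbf x_k-\eta\,\hat{\mathbf g}^x(\mathbf x_k^+,\mathbf y_k^+;r_k)],\quad \mathbf y_{k+1}=\mathcal P_{\mathcal Y}[\mathbf y_k+\eta\,\hat{\mathbf g}^y(\mathbf x_k^+,\mathbf y_k^+;r_k)],$$ with $\mathbf z_k=(\mathbf x_k,\mathbf y_k)$, $\mathbf z_k^+=(\mathbf x_k^+,\mathbf y_k^+)$.
   Formalization: Added: f is differentiable with L-Lipschitz gradient on a set containing Z and the segments from all iterates z_k, z_k^+ to their query points (not only on Z); the last bound, on φ_0(x̂_K) − φ_0^*, also assumes 0 ∈ Y. Without these the claim is false. *)

theory Defs
  imports "HOL-Analysis.Analysis"
begin

definition is_saddle_point ::
    "('a \<times> 'b \<Rightarrow> real) \<Rightarrow> 'a set \<Rightarrow> 'b set \<Rightarrow> 'a \<times> 'b \<Rightarrow> bool" where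
  "is_saddle_point f X Y zs \<longleftrightarrow> zs \<in> X \<times> Y \<and>
     (\<forall>x\<in>X. \<forall>y\<in>Y. f (fst zs, y) \<le> f zs \<and> f zs \<le> f (x, snd zs))"

definition duality_gap :: "('a \<times> 'b \<Rightarrow> real) \<Rightarrow> 'a \<times> 'b \<Rightarrow> 'a \<times> 'b \<Rightarrow> real" where
  "duality_gap f zs z = f (fst z, snd zs) - f (fst zs, snd z)"

definition fd_grad_x ::
    "((real ^ 'n) \<times> (real ^ 'm) \<Rightarrow> real) \<Rightarrow> real \<Rightarrow> (real ^ 'n) \<times> (real ^ 'm) \<Rightarrow> real ^ 'n" where
  "fd_grad_x f r z =
     (\<Sum>i\<in>UNIV. ((f (fst z + r *\<^sub>R axis i 1, snd z) - f z) / r) *\<^sub>R axis i 1)"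

definition fd_grad_y ::
    "((real ^ 'n) \<times> (real ^ 'm) \<Rightarrow> real) \<Rightarrow> real \<Rightarrow> (real ^ 'n) \<times> (real ^ 'm) \<Rightarrow> real ^ 'm" where
  "fd_grad_y f r z =
     (\<Sum>j\<in>UNIV. ((f (fst z, snd z + r *\<^sub>R axis j 1) - f z) / r) *\<^sub>R axis j 1)"

text \<open>The segments joining \<open>z\<close> to the points at which the two finite-difference estimators
  at \<open>z\<close> query \<open>f\<close>. For \<open>z\<close> in \<open>X \<times> Y\<close> they may leave \<open>X \<times> Y\<close>, so bounding the error of the
  estimators needs smoothness of \<open>f\<close> on these segments as well.\<close>

definition query_segments ::
    "real \<Rightarrow> (real ^ 'n) \<times> (real ^ 'm) \<Rightarrow> ((real ^ 'n) \<times> (real ^ 'm)) set" where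
  "query_segments r z =
     (\<Union>i. closed_segment z (fst z + r *\<^sub>R axis i 1, snd z)) \<union>
     (\<Union>j. closed_segment z (fst z, snd z + r *\<^sub>R axis j 1))"

text \<open>A projected descent-ascent step from \<open>z\<close> using the estimators at \<open>w\<close>: the extrapolation
  step takes \<open>w = z\<close>, the update step takes for \<open>w\<close> the extrapolated point.\<close>

definition zoceg_step ::
    "((real ^ 'n) \<times> (real ^ 'm) \<Rightarrow> real) \<Rightarrow> (real ^ 'n) set \<Rightarrow> (real ^ 'm) set \<Rightarrow> real \<Rightarrow> real \<Rightarrow>
     (real ^ 'n) \<times> (real ^ 'm) \<Rightarrow> (real ^ 'n) \<times> (real ^ 'm) \<Rightarrow> (real ^ 'n) \<times> (real ^ 'm)" where
  "zoceg_step f X Y \<eta> r z w =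
     (closest_point X (fst z - \<eta> *\<^sub>R fd_grad_x f r w),
      closest_point Y (snd z + \<eta> *\<^sub>R fd_grad_y f r w))"

primrec zoceg ::
    "((real ^ 'n) \<times> (real ^ 'm) \<Rightarrow> real) \<Rightarrow> (real ^ 'n) set \<Rightarrow> (real ^ 'm) set \<Rightarrow> real \<Rightarrow>
     (nat \<Rightarrow> real) \<Rightarrow> (real ^ 'n) \<times> (real ^ 'm) \<Rightarrow> nat \<Rightarrow> (real ^ 'n) \<times> (real ^ 'm)" where
  "zoceg f X Y \<eta> r z0 0 = z0"
| "zoceg f X Y \<eta> r z0 (Suc k) =
     (let z = zoceg f X Y \<eta> r z0 k
      in zoceg_step f X Y \<eta> (r k) z (zoceg_step f X Y \<eta> (r k) z z))"

definition zoceg_plus ::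
    "((real ^ 'n) \<times> (real ^ 'm) \<Rightarrow> real) \<Rightarrow> (real ^ 'n) set \<Rightarrow> (real ^ 'm) set \<Rightarrow> real \<Rightarrow>
     (nat \<Rightarrow> real) \<Rightarrow> (real ^ 'n) \<times> (real ^ 'm) \<Rightarrow> nat \<Rightarrow> (real ^ 'n) \<times> (real ^ 'm)" where
  "zoceg_plus f X Y \<eta> r z0 k =
     zoceg_step f X Y \<eta> (r k) (zoceg f X Y \<eta> r z0 k) (zoceg f X Y \<eta> r z0 k)"

definition zoceg_avg ::
    "((real ^ 'n) \<times> (real ^ 'm) \<Rightarrow> real) \<Rightarrow> (real ^ 'n) set \<Rightarrow> (real ^ 'm) set \<Rightarrow> real \<Rightarrow>
     (nat \<Rightarrow> real) \<Rightarrow> (real ^ 'n) \<times> (real ^ 'm) \<Rightarrow> nat \<Rightarrow> (real ^ 'n) \<times> (real ^ 'm)" where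
  "zoceg_avg f X Y \<eta> r z0 K = (1 / real K) *\<^sub>R (\<Sum>k<K. zoceg_plus f X Y \<eta> r z0 k)"

definition lagrangian ::
    "(real ^ 'n \<Rightarrow> real) \<Rightarrow> (real ^ 'n \<Rightarrow> real ^ 'm) \<Rightarrow> (real ^ 'n) \<times> (real ^ 'm) \<Rightarrow> real" where
  "lagrangian \<phi>\<^sub>0 \<phi> z = \<phi>\<^sub>0 (fst z) + (\<Sum>j\<in>UNIV. snd z $ j * \<phi> (fst z) $ j)"

definition pos_part :: "real ^ 'm \<Rightarrow> real ^ 'm" where
  "pos_part v = (\<chi> j. max (v $ j) 0)"

definition is_max_radius :: "'a::real_normed_vector set \<Rightarrow> 'a \<Rightarrow> real \<Rightarrow> bool" where
  "is_max_radius Y y R \<longleftrightarrow>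
     is_arg_max (\<lambda>r. r) (\<lambda>r. r > 0 \<and> (\<forall>u. norm u = 1 \<longrightarrow> y + r *\<^sub>R u \<in> Y)) R"

end

theory Submission
  imports Defs
begin

text \<open>ZOCEG is the extragradient method for the monotone field \<open>(\<nabla>\<^sub>x f, - \<nabla>\<^sub>y f)\<close>, evaluated with
  an error of at most \<open>\<delta>\<^sub>k = L r\<^sub>k (\<surd>d\<^sub>x + \<surd>d\<^sub>y) / 2\<close>. Hence a step decreases
  \<open>\<parallel>z\<^sub>k - u\<parallel>\<^sup>2\<close> by at least \<open>2 \<eta>\<close> times the gap at \<open>z\<^sub>k\<^sup>+\<close> relative to \<open>u\<close>, up to \<open>6 \<eta> \<delta>\<^sub>k D\<close>, and after
  telescoping and Jensen \<open>f (x\<^sub>K, v) - f (w, y\<^sub>K) \<le> \<epsilon>\<close> at the average, for \<^emph>\<open>all\<close> \<open>(w, v)\<close> in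
  \<open>X \<times> Y\<close>. In the Lagrangian case \<open>w\<close> is the optimal point and \<open>v\<close> is either \<open>0\<close> or the optimal
  multiplier shifted by \<open>R\<close> in the direction of the constraint violation.\<close>

section \<open>First-order estimates along segments\<close>

lemma GDERIV_line:
  assumes "GDERIV f (z + t *\<^sub>R h) :> d"
  shows "((\<lambda>s. f (z + s *\<^sub>R h)) has_real_derivative inner d h) (at t within T)"
proof -
  have 1: "(f has_derivative (\<lambda>h. inner h d)) (at (z + t *\<^sub>R h))"
    using assms by (simp add: gderiv_def)
  have 2: "((\<lambda>s. z + s *\<^sub>R h) has_derivative (\<lambda>s. s *\<^sub>R h)) (at t)"
    by (auto intro!: derivative_eq_intros)
  have "((\<lambda>s. f (z + s *\<^sub>R h)) has_derivative (\<lambda>s. inner (s *\<^sub>R h) d)) (at t)"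
    using has_derivative_compose[OF 2 1] by simp
  moreover have "(\<lambda>s. inner (s *\<^sub>R h) d) = (*) (inner d h)"
    by (auto simp: inner_commute mult.commute)
  ultimately show ?thesis
    by (simp add: has_field_derivative_def has_derivative_at_withinI)
qed

text \<open>Convexity bounds every right difference quotient at 0 by the full secant, and the bound
  survives the limit. Convexity is asked for along one segment only: \<open>f\<close> is convex in
  just one block of variables, and the concave block is treated by the same lemma for
  \<open>- f\<close>.\<close>

lemma gradient_le_secant:
  fixes f :: "'a::real_inner \<Rightarrow> real"
  assumes d: "GDERIV f z :> d"
    and le: "\<And>t. 0 < t \<Longrightarrow> t < 1 \<Longrightarrow> f (z + t *\<^sub>R h) \<le> (1 - t) * f z + t * f (z + h)"
  shows "inner d h \<le> f (z + h) - f z"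
proof -
  have "((\<lambda>s. f (z + s *\<^sub>R h)) has_real_derivative inner d h) (at_right 0)"
    using GDERIV_line[of f z 0 h d] d by simp
  hence lim: "((\<lambda>t. (f (z + t *\<^sub>R h) - f z) / t) \<longlongrightarrow> inner d h) (at_right 0)"
    by (simp add: has_field_derivative_iff)
  have "\<forall>\<^sub>F t in at_right 0. (f (z + t *\<^sub>R h) - f z) / t \<le> f (z + h) - f z"
    using eventually_at_right_real[OF zero_less_one]
  proof eventually_elim
    case (elim t)
    then have "f (z + t *\<^sub>R h) - f z \<le> t * (f (z + h) - f z)"
      using le[of t] by (simp add: algebra_simps)
    with elim show ?case by (simp add: divide_le_eq mult.commute)
  qed
  thus ?thesis by (rule tendsto_upperbound[OF lim]) simp
qed

text \<open>\<open>G\<close> is the first-order remainder along the segment minus the claimed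
  quadratic bound at scale \<open>t\<close>. By Cauchy-Schwarz and the Lipschitz bound its
  derivative is nonpositive, so \<open>G 1 \<le> G 0\<close>. Asking only for the segment to lie in
  \<open>W\<close> lets \<open>W\<close> be any set that contains the query segments.\<close>

lemma smooth_upper_bound:
  fixes f :: "'a::real_inner \<Rightarrow> real"
  assumes seg: "closed_segment z (z + h) \<subseteq> W"
    and d: "\<And>w. w \<in> W \<Longrightarrow> GDERIV f w :> g w"
    and lip: "\<And>v w. v \<in> W \<Longrightarrow> w \<in> W \<Longrightarrow> norm (g v - g w) \<le> L * norm (v - w)"
  shows "f (z + h) - f z - inner (g z) h \<le> L / 2 * (norm h)\<^sup>2"
proof -
  have inW: "z + t *\<^sub>R h \<in> W" if "0 \<le> t" "t \<le> 1" for t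
  proof -
    have "z + t *\<^sub>R h = (1 - t) *\<^sub>R z + t *\<^sub>R (z + h)" by (simp add: algebra_simps)
    with that seg show ?thesis by (auto simp: closed_segment_def)
  qed
  have zW: "z \<in> W" using inW[of 0] by simp
  define G where "G = (\<lambda>t. f (z + t *\<^sub>R h) - t * inner (g z) h - L / 2 * t\<^sup>2 * (norm h)\<^sup>2)"
  have "G 1 \<le> G 0"
  proof (rule DERIV_nonpos_imp_nonincreasing[where f = G and a = 0 and b = 1])
    fix t :: real assume t: "0 \<le> t" "t \<le> 1"
    have "(G has_real_derivative
        inner (g (z + t *\<^sub>R h)) h - inner (g z) h - L * t * (norm h)\<^sup>2) (at t)"
      unfolding G_def
      by (rule derivative_eq_intros GDERIV_line d inW t refl | simp)+
    moreover have "inner (g (z + t *\<^sub>R h) - g z) h \<le> norm (g (z + t *\<^sub>R h) - g z) * norm h"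
      by (rule norm_cauchy_schwarz)
    moreover have "\<dots> \<le> (L * norm (t *\<^sub>R h)) * norm h"
      using lip[OF inW[OF t] zW] by (intro mult_right_mono) simp_all
    moreover have "(L * norm (t *\<^sub>R h)) * norm h = L * t * (norm h)\<^sup>2"
      using t by (simp add: power2_eq_square)
    ultimately show "\<exists>y. (G has_real_derivative y) (at t) \<and> y \<le> 0"
      by (intro exI[of _ "inner (g (z + t *\<^sub>R h)) h - inner (g z) h - L * t * (norm h)\<^sup>2"])
        (auto simp only: inner_diff_left)
  qed simp
  thus ?thesis by (simp add: G_def)
qed

text \<open>The missing lower bound is the upper bound for \<open>- f\<close>, whose gradient
  \<open>- g\<close> has the same Lipschitz constant.\<close>

lemma smooth_first_order_error:
  fixes f :: "'a::real_inner \<Rightarrow> real"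
  assumes seg: "closed_segment z (z + h) \<subseteq> W"
    and d: "\<And>w. w \<in> W \<Longrightarrow> GDERIV f w :> g w"
    and lip: "\<And>v w. v \<in> W \<Longrightarrow> w \<in> W \<Longrightarrow> norm (g v - g w) \<le> L * norm (v - w)"
  shows "\<bar>f (z + h) - f z - inner (g z) h\<bar> \<le> L / 2 * (norm h)\<^sup>2"
proof -
  have "norm (- g v - - g w) \<le> L * norm (v - w)" if "v \<in> W" "w \<in> W" for v w
    using lip[OF that(2,1)] by (simp add: norm_minus_commute)
  from smooth_upper_bound[OF seg GDERIV_minus[OF d] this]
  have "- f (z + h) - - f z - inner (- g z) h \<le> L / 2 * (norm h)\<^sup>2" .
  with smooth_upper_bound[OF assms] show ?thesis
    unfolding inner_minus_left by (intro abs_leI; linarith)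
qed

section \<open>Error of the finite-difference estimators\<close>

lemma norm_le_sqrt_CARD:
  fixes v :: "real ^ 'n"
  assumes "\<And>i. \<bar>v $ i\<bar> \<le> c"
  shows "norm v \<le> sqrt CARD('n) * c"
proof -
  have c: "0 \<le> c" using order_trans[OF abs_ge_zero assms] .
  have "(\<Sum>i\<in>UNIV. (v $ i)\<^sup>2) \<le> (\<Sum>i\<in>(UNIV :: 'n set). c\<^sup>2)"
    using assms c by (intro sum_mono abs_le_square_iff[THEN iffD1]) simp
  hence "sqrt (\<Sum>i\<in>UNIV. (v $ i)\<^sup>2) \<le> sqrt (CARD('n) * c\<^sup>2)"
    by (intro real_sqrt_le_mono) simp
  thus ?thesis using c by (simp add: norm_vec_def L2_set_def real_sqrt_mult)
qed

lemma component_sum_axis: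
  fixes c :: "'n::finite \<Rightarrow> real"
  shows "(\<Sum>i\<in>UNIV. c i *\<^sub>R axis i (1 :: real)) $ j = c j"
  by (simp add: axis_def if_distrib cong: if_cong)

text \<open>Dividing the quadratic remainder by \<open>r\<close> leaves an error linear in
  \<open>r\<close>; this is why a bound on the sum of the radii controls the accumulated
  error.\<close>

lemma fd_component_error:
  assumes "\<bar>(a :: real) - b - r * c\<bar> \<le> L / 2 * r\<^sup>2" "0 < r"
  shows "\<bar>(a - b) / r - c\<bar> \<le> L * r / 2"
proof -
  have "(a - b) / r - c = (a - b - r * c) / r"
    using assms(2) by (simp add: field_simps)
  hence "\<bar>(a - b) / r - c\<bar> = \<bar>a - b - r * c\<bar> / r"
    using assms(2) by simp
  also have "\<dots> \<le> L * r / 2"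
    using assms by (simp add: divide_le_eq power2_eq_square field_simps)
  finally show ?thesis .
qed

text \<open>Each coordinate is a forward difference along an axis segment of length
  \<open>r\<close>, with error at most \<open>L * r / 2\<close>; passing from coordinates to the
  Euclidean norm costs the square root of the dimension.\<close>

lemma fd_grad_x_error:
  fixes f :: "(real ^ 'n) \<times> (real ^ 'm) \<Rightarrow> real"
  assumes seg: "query_segments r z \<subseteq> W" and r: "0 < r"
    and d: "\<And>w. w \<in> W \<Longrightarrow> GDERIV f w :> g w"
    and lip: "\<And>v w. v \<in> W \<Longrightarrow> w \<in> W \<Longrightarrow> norm (g v - g w) \<le> L * norm (v - w)"
  shows "norm (fd_grad_x f r z - fst (g z)) \<le> sqrt CARD('n) * (L * r / 2)"
proof (rule norm_le_sqrt_CARD)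
  fix i
  have pt: "z + (r *\<^sub>R axis i 1, 0) = (fst z + r *\<^sub>R axis i 1, snd z)"
    by (simp add: prod_eq_iff)
  have "closed_segment z (z + (r *\<^sub>R axis i 1, 0)) \<subseteq> W"
    using seg unfolding pt query_segments_def by blast
  from smooth_first_order_error[OF this d lip] r
  have "\<bar>f (fst z + r *\<^sub>R axis i 1, snd z) - f z - r * fst (g z) $ i\<bar> \<le> L / 2 * r\<^sup>2"
    unfolding pt by (simp add: inner_prod_def inner_axis norm_Pair)
  from fd_component_error[OF this r]
  show "\<bar>(fd_grad_x f r z - fst (g z)) $ i\<bar> \<le> L * r / 2"
    unfolding fd_grad_x_def by (simp only: vector_minus_component component_sum_axis)
qed

lemma fd_grad_y_error:
  fixes f :: "(real ^ 'n) \<times> (real ^ 'm) \<Rightarrow> real"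
  assumes seg: "query_segments r z \<subseteq> W" and r: "0 < r"
    and d: "\<And>w. w \<in> W \<Longrightarrow> GDERIV f w :> g w"
    and lip: "\<And>v w. v \<in> W \<Longrightarrow> w \<in> W \<Longrightarrow> norm (g v - g w) \<le> L * norm (v - w)"
  shows "norm (fd_grad_y f r z - snd (g z)) \<le> sqrt CARD('m) * (L * r / 2)"
proof (rule norm_le_sqrt_CARD)
  fix j
  have pt: "z + (0, r *\<^sub>R axis j 1) = (fst z, snd z + r *\<^sub>R axis j 1)"
    by (simp add: prod_eq_iff)
  have "closed_segment z (z + (0, r *\<^sub>R axis j 1)) \<subseteq> W"
    using seg unfolding pt query_segments_def by blast
  from smooth_first_order_error[OF this d lip] r
  have "\<bar>f (fst z, snd z + r *\<^sub>R axis j 1) - f z - r * snd (g z) $ j\<bar> \<le> L / 2 * r\<^sup>2"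
    unfolding pt by (simp add: inner_prod_def inner_axis norm_Pair)
  from fd_component_error[OF this r]
  show "\<bar>(fd_grad_y f r z - snd (g z)) $ j\<bar> \<le> L * r / 2"
    unfolding fd_grad_y_def by (simp only: vector_minus_component component_sum_axis)
qed

section \<open>The descent-ascent field and its estimator\<close>

text \<open>The sign flip lets descent in \<open>x\<close> and ascent in \<open>y\<close> be written
  as a single step against one field on the product space.\<close>

definition saddle_field :: "'a \<times> 'b \<Rightarrow> 'a \<times> 'b::uminus" where
  "saddle_field g = (fst g, - snd g)"

definition fd_field ::
    "((real ^ 'n) \<times> (real ^ 'm) \<Rightarrow> real) \<Rightarrow> real \<Rightarrow> (real ^ 'n) \<times> (real ^ 'm) \<Rightarrow>
     (real ^ 'n) \<times> (real ^ 'm)" where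
  "fd_field f r z = saddle_field (fd_grad_x f r z, fd_grad_y f r z)"

text \<open>The sign flip is an isometry, so Lipschitz and error bounds pass from gradients to
  fields with unchanged constants.\<close>

lemma norm_saddle_field_diff:
  fixes a b :: "'a::real_normed_vector \<times> 'b::real_normed_vector"
  shows "norm (saddle_field a - saddle_field b) = norm (a - b)"
proof -
  have "norm (- snd a + snd b) = norm (snd a - snd b)"
    using norm_minus_commute[of "snd b" "snd a"] by simp
  thus ?thesis by (simp add: saddle_field_def norm_prod_def)
qed

lemma fd_field_error:
  fixes f :: "(real ^ 'n) \<times> (real ^ 'm) \<Rightarrow> real"
  assumes "query_segments r z \<subseteq> W" and "0 < r"
    and "\<And>w. w \<in> W \<Longrightarrow> GDERIV f w :> g w"
    and "\<And>v w. v \<in> W \<Longrightarrow> w \<in> W \<Longrightarrow> norm (g v - g w) \<le> L * norm (v - w)"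
  shows "norm (fd_field f r z - saddle_field (g z))
    \<le> (sqrt CARD('n) + sqrt CARD('m)) * (L * r / 2)"
proof -
  have "norm (fd_field f r z - saddle_field (g z))
      = norm (fd_grad_x f r z - fst (g z), fd_grad_y f r z - snd (g z))"
    unfolding fd_field_def norm_saddle_field_diff by (cases "g z") simp
  also have "\<dots> \<le> norm (fd_grad_x f r z - fst (g z)) + norm (fd_grad_y f r z - snd (g z))"
    by (rule norm_Pair_le)
  also have "\<dots> \<le> sqrt CARD('n) * (L * r / 2) + sqrt CARD('m) * (L * r / 2)"
    using fd_grad_x_error[OF assms] fd_grad_y_error[OF assms] by (rule add_mono)
  finally show ?thesis by (simp add: distrib_right)
qed

section \<open>Projected steps and the inexact extragradient inequality\<close>

lemma zoceg_step_in:
  assumes "compact X" "compact Y" "X \<noteq> {}" "Y \<noteq> {}"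
  shows "zoceg_step f X Y \<eta> r z w \<in> X \<times> Y"
  using assms by (simp add: zoceg_step_def closest_point_in_set compact_imp_closed)

text \<open>Each factor satisfies the variational inequality of its own projection. The inner
  product of pairs is the sum over the factors, so adding the two gives the inequality for
  projecting onto the product.\<close>

lemma zoceg_step_variational:
  assumes "compact X" "convex X" "compact Y" "convex Y" and u: "u \<in> X \<times> Y"
  shows "inner (z - \<eta> *\<^sub>R fd_field f r w - zoceg_step f X Y \<eta> r z w)
    (u - zoceg_step f X Y \<eta> r z w) \<le> 0"
proof -
  let ?a = "fst z - \<eta> *\<^sub>R fd_grad_x f r w" and ?b = "snd z + \<eta> *\<^sub>R fd_grad_y f r w"
  have "inner (?a - closest_point X ?a) (fst u - closest_point X ?a) \<le> 0"
    "inner (?b - closest_point Y ?b) (snd u - closest_point Y ?b) \<le> 0"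
    using assms by (auto intro!: closest_point_dot simp: compact_imp_closed)
  thus ?thesis
    by (simp add: inner_prod_def zoceg_step_def fd_field_def saddle_field_def)
qed

text \<open>The inequality defining \<open>p\<close> is tested at \<open>q\<close>, the one defining
  \<open>q\<close> at \<open>u\<close>. Polarization turns both into squared norms, the squared
  distance from \<open>z\<close> to \<open>q\<close> cancels in the sum, and only the mismatch
  \<open>b - a\<close> on \<open>p - q\<close> remains.\<close>

lemma extragradient_ineq:
  fixes z p q u a b :: "'a::real_inner"
  assumes p: "inner (z - \<eta> *\<^sub>R a - p) (q - p) \<le> 0"
    and q: "inner (z - \<eta> *\<^sub>R b - q) (u - q) \<le> 0"
  shows "2 * \<eta> * inner b (p - u) \<le> (norm (z - u))\<^sup>2 - (norm (q - u))\<^sup>2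
    - (norm (z - p))\<^sup>2 - (norm (p - q))\<^sup>2 + 2 * \<eta> * inner (b - a) (p - q)"
proof -
  have polar: "2 * inner (x - y) (y - w) = (norm (x - w))\<^sup>2 - (norm (x - y))\<^sup>2 - (norm (y - w))\<^sup>2"
    for x y w :: 'a
    using dot_norm[of "x - y" "y - w"] by simp
  have "inner (z - \<eta> *\<^sub>R a - p) (q - p) = \<eta> * inner a (p - q) - inner (z - p) (p - q)"
    by (simp add: inner_diff_left inner_diff_right right_diff_distrib)
  with p polar[of z p q]
  have "2 * \<eta> * inner a (p - q) \<le> (norm (z - q))\<^sup>2 - (norm (z - p))\<^sup>2 - (norm (p - q))\<^sup>2"
    by simp
  moreover have "inner (z - \<eta> *\<^sub>R b - q) (u - q) = \<eta> * inner b (q - u) - inner (z - q) (q - u)"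
    by (simp add: inner_diff_left inner_diff_right right_diff_distrib)
  with q polar[of z q u]
  have "2 * \<eta> * inner b (q - u) \<le> (norm (z - u))\<^sup>2 - (norm (z - q))\<^sup>2 - (norm (q - u))\<^sup>2"
    by simp
  moreover have "2 * \<eta> * inner b (p - u)
      = 2 * \<eta> * inner b (q - u) + 2 * \<eta> * inner a (p - q) + 2 * \<eta> * inner (b - a) (p - q)"
    by (simp add: inner_diff_left inner_diff_right right_diff_distrib)
  ultimately show ?thesis by linarith
qed

text \<open>Here \<open>a\<close> and \<open>b\<close> approximate the exact field values
  \<open>A\<close> at \<open>z\<close> and \<open>B\<close> at \<open>p\<close>. The Lipschitz part
  of the mismatch is absorbed by the two negative squares, since \<open>\<eta> * L \<le> 1\<close>.
  Three error pairings remain, \<open>b - B\<close> and \<open>A - a\<close> with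
  \<open>p - q\<close> and \<open>B - b\<close> with \<open>p - u\<close>; each costs
  \<open>2 * \<eta> * \<delta> * D\<close>, hence the factor 6.\<close>

lemma extragradient_step:
  fixes z p q u a b A B :: "'a::real_inner"
  assumes p: "inner (z - \<eta> *\<^sub>R a - p) (q - p) \<le> 0"
    and q: "inner (z - \<eta> *\<^sub>R b - q) (u - q) \<le> 0"
    and a: "norm (a - A) \<le> \<delta>" and b: "norm (b - B) \<le> \<delta>"
    and lip: "norm (B - A) \<le> L * norm (p - z)"
    and pq: "norm (p - q) \<le> D" and pu: "norm (p - u) \<le> D"
    and \<eta>: "0 \<le> \<eta>" "\<eta> * L \<le> 1" "0 \<le> L"
  shows "2 * \<eta> * inner B (p - u) \<le> (norm (z - u))\<^sup>2 - (norm (q - u))\<^sup>2 + 6 * \<eta> * \<delta> * D"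
proof -
  have \<delta>: "0 \<le> \<delta>" using order_trans[OF norm_ge_zero a] .
  have "inner (b - a) (p - q)
      = inner (B - A) (p - q) + inner (b - B) (p - q) + inner (A - a) (p - q)"
    by (simp add: inner_diff_left)
  moreover have "inner (B - A) (p - q) \<le> L * norm (p - z) * norm (p - q)"
    by (rule order_trans[OF norm_cauchy_schwarz mult_right_mono[OF lip]]) simp
  moreover have "inner (b - B) (p - q) \<le> \<delta> * D"
    by (rule order_trans[OF norm_cauchy_schwarz mult_mono[OF b pq \<delta>]]) simp
  moreover have "inner (A - a) (p - q) \<le> \<delta> * D"
    using a by (intro order_trans[OF norm_cauchy_schwarz mult_mono[OF _ pq \<delta>]])
      (simp_all add: norm_minus_commute)
  ultimately have "inner (b - a) (p - q) \<le> L * norm (p - z) * norm (p - q) + 2 * (\<delta> * D)"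
    by linarith
  hence "2 * \<eta> * inner (b - a) (p - q)
      \<le> 2 * \<eta> * (L * norm (p - z) * norm (p - q) + 2 * (\<delta> * D))"
    using \<eta> by (intro mult_left_mono) auto
  also have "\<dots> = (\<eta> * L) * (2 * norm (p - z) * norm (p - q)) + 4 * \<eta> * \<delta> * D"
    by (simp add: algebra_simps)
  also have "(\<eta> * L) * (2 * norm (p - z) * norm (p - q)) \<le> 1 * (2 * norm (p - z) * norm (p - q))"
    using \<eta> by (intro mult_right_mono) auto
  also have "\<dots> \<le> (norm (z - p))\<^sup>2 + (norm (p - q))\<^sup>2"
    using sum_squares_bound[of "norm (p - z)" "norm (p - q)"] by (simp add: norm_minus_commute)
  finally have cross: "2 * \<eta> * inner (b - a) (p - q)
      \<le> (norm (z - p))\<^sup>2 + (norm (p - q))\<^sup>2 + 4 * \<eta> * \<delta> * D" by simp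
  have "inner (B - b) (p - u) \<le> \<delta> * D"
    using b by (intro order_trans[OF norm_cauchy_schwarz mult_mono[OF _ pu \<delta>]])
      (simp_all add: norm_minus_commute)
  hence "2 * \<eta> * inner (B - b) (p - u) \<le> 2 * \<eta> * (\<delta> * D)"
    using \<eta> by (intro mult_left_mono) auto
  hence "2 * \<eta> * inner B (p - u) \<le> 2 * \<eta> * inner b (p - u) + 2 * \<eta> * \<delta> * D"
    by (simp add: inner_diff_left algebra_simps)
  with extragradient_ineq[OF p q] cross show ?thesis by simp
qed

section \<open>Saddle gaps, at a point and at an average\<close>

text \<open>One gradient inequality in \<open>x\<close> with \<open>snd z\<close> fixed and one in
  \<open>y\<close> with \<open>fst z\<close> fixed; on adding them \<open>f z\<close> cancels and
  the two linear terms form the pairing with the field.\<close>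

lemma saddle_gap_le_inner:
  fixes f :: "'a::real_inner \<times> 'b::real_inner \<Rightarrow> real"
  assumes cx: "convex_on X (\<lambda>x. f (x, snd z))" and cy: "concave_on Y (\<lambda>y. f (fst z, y))"
    and z: "z \<in> X \<times> Y" and u: "u \<in> X \<times> Y" and d: "GDERIV f z :> g"
  shows "f (fst z, snd u) - f (fst u, snd z) \<le> inner (saddle_field g) (z - u)"
proof -
  have "inner g (fst u - fst z, 0) \<le> f (z + (fst u - fst z, 0)) - f z"
  proof (rule gradient_le_secant[OF d])
    fix t :: real assume t: "0 < t" "t < 1"
    have "f ((1 - t) *\<^sub>R fst z + t *\<^sub>R fst u, snd z)
        \<le> (1 - t) * f (fst z, snd z) + t * f (fst u, snd z)"
      using z u t by (intro convex_onD[OF cx]) auto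
    moreover have "z + t *\<^sub>R (fst u - fst z, 0) = ((1 - t) *\<^sub>R fst z + t *\<^sub>R fst u, snd z)"
      "z + (fst u - fst z, 0) = (fst u, snd z)"
      by (auto simp: prod_eq_iff algebra_simps)
    ultimately show "f (z + t *\<^sub>R (fst u - fst z, 0))
        \<le> (1 - t) * f z + t * f (z + (fst u - fst z, 0))" by simp
  qed
  moreover have "inner (- g) (0, snd u - snd z) \<le> - f (z + (0, snd u - snd z)) - - f z"
  proof (rule gradient_le_secant[OF GDERIV_minus[OF d]])
    fix t :: real assume t: "0 < t" "t < 1"
    have "- f (fst z, (1 - t) *\<^sub>R snd z + t *\<^sub>R snd u)
        \<le> (1 - t) * - f (fst z, snd z) + t * - f (fst z, snd u)"
      using z u t cy[unfolded concave_on_def]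
      by (intro convex_onD[where f = "\<lambda>y. - f (fst z, y)" and A = Y]) auto
    moreover have "z + t *\<^sub>R (0, snd u - snd z) = (fst z, (1 - t) *\<^sub>R snd z + t *\<^sub>R snd u)"
      "z + (0, snd u - snd z) = (fst z, snd u)"
      by (auto simp: prod_eq_iff algebra_simps)
    ultimately show "- f (z + t *\<^sub>R (0, snd u - snd z))
        \<le> (1 - t) * - f z + t * - f (z + (0, snd u - snd z))" by simp
  qed
  moreover have "z + (fst u - fst z, 0) = (fst u, snd z)" "z + (0, snd u - snd z) = (fst z, snd u)"
    by (simp_all add: prod_eq_iff)
  ultimately show ?thesis
    by (simp add: inner_prod_def saddle_field_def inner_diff_right)
qed

text \<open>Jensen's inequality in each block separately, the concave one through
  \<open>- f\<close>.\<close>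

lemma average_saddle_gap:
  fixes f :: "'a::real_vector \<times> 'b::real_vector \<Rightarrow> real"
  assumes cx: "convex_on X (\<lambda>x. f (x, b))" and cy: "concave_on Y (\<lambda>y. f (a, y))"
    and z: "\<And>k. z k \<in> X \<times> Y" and K: "0 < K"
  defines "zh \<equiv> (1 / real K) *\<^sub>R (\<Sum>k<K. z k)"
  shows "f (fst zh, b) - f (a, snd zh) \<le> (\<Sum>k<K. f (fst (z k), b) - f (a, snd (z k))) / real K"
proof -
  have zh: "fst zh = (\<Sum>k<K. (1 / real K) *\<^sub>R fst (z k))"
    "snd zh = (\<Sum>k<K. (1 / real K) *\<^sub>R snd (z k))"
    by (simp_all add: zh_def fst_sum snd_sum scaleR_sum_right)
  have "f (fst zh, b) \<le> (\<Sum>k<K. (1 / real K) * f (fst (z k), b))"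
    unfolding zh using K z by (intro convex_on_sum[OF _ _ cx]) (auto simp: mem_Times_iff)
  moreover have "- f (a, snd zh) \<le> (\<Sum>k<K. (1 / real K) * - f (a, snd (z k)))"
    unfolding zh using K z
    by (intro convex_on_sum[OF _ _ cy[unfolded concave_on_def]]) (auto simp: mem_Times_iff)
  ultimately show ?thesis
    by (simp add: sum_subtractf sum_negf sum_divide_distrib diff_divide_distrib)
qed

section \<open>The gap bound for the averaged iterates\<close>

lemma norm_diff_le_diameter:
  assumes "compact X" "compact Y" "u \<in> X \<times> Y" "v \<in> X \<times> Y"
  shows "norm (u - v) \<le> diameter (X \<times> Y)"
  using diameter_bounded_bound[OF compact_imp_bounded[OF compact_Times[OF assms(1,2)]] assms(3,4)]
  by (simp add: dist_norm)

text \<open>The comparison point \<open>u\<close> is arbitrary in \<open>X \<times> Y\<close>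
  because the Lagrangian bounds compare with multipliers other than that of the saddle
  point.\<close>

lemma zoceg_avg_gap:
  fixes f :: "(real ^ 'n) \<times> (real ^ 'm) \<Rightarrow> real"
  assumes X: "compact X" "convex X" and Y: "compact Y" "convex Y"
    and cx: "\<And>y. y \<in> Y \<Longrightarrow> convex_on X (\<lambda>x. f (x, y))"
    and cy: "\<And>x. x \<in> X \<Longrightarrow> concave_on Y (\<lambda>y. f (x, y))"
    and W: "X \<times> Y \<subseteq> W"
    and d: "\<And>w. w \<in> W \<Longrightarrow> GDERIV f w :> g w"
    and lip: "\<And>v w. v \<in> W \<Longrightarrow> w \<in> W \<Longrightarrow> norm (g v - g w) \<le> L * norm (v - w)"
    and \<eta>: "0 < \<eta>" "\<eta> * L \<le> 1" "0 \<le> L"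
    and r: "\<And>k. 0 < r k"
    and z0: "z0 \<in> X \<times> Y"
    and q: "\<And>k. query_segments (r k) (zoceg f X Y \<eta> r z0 k) \<subseteq> W"
    and qp: "\<And>k. query_segments (r k) (zoceg_plus f X Y \<eta> r z0 k) \<subseteq> W"
    and K: "0 < K" and u: "u \<in> X \<times> Y"
  defines "zh \<equiv> zoceg_avg f X Y \<eta> r z0 K" and "D \<equiv> diameter (X \<times> Y)"
  shows "f (fst zh, snd u) - f (fst u, snd zh)
    \<le> (D\<^sup>2 / \<eta> + 3 * L * ((sqrt CARD('n) + sqrt CARD('m)) * (\<Sum>k<K. r k)) * D) / (2 * real K)"
proof -
  define z where "z = zoceg f X Y \<eta> r z0"
  define p where "p = zoceg_plus f X Y \<eta> r z0"
  define c where "c = sqrt CARD('n) + sqrt CARD('m)"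
  have ne: "X \<noteq> {}" "Y \<noteq> {}" using z0 by auto
  have p_eq: "p k = zoceg_step f X Y \<eta> (r k) (z k) (z k)" for k
    by (simp add: p_def z_def zoceg_plus_def)
  have z_Suc: "z (Suc k) = zoceg_step f X Y \<eta> (r k) (z k) (p k)" for k
    by (simp add: p_def z_def zoceg_plus_def Let_def)
  have pin: "p k \<in> X \<times> Y" for k
    unfolding p_eq using X Y ne by (intro zoceg_step_in)
  have zin: "z k \<in> X \<times> Y" for k
  proof (cases k)
    case 0 thus ?thesis using z0 by (simp add: z_def)
  next
    case (Suc j) thus ?thesis unfolding Suc z_Suc using X Y ne by (intro zoceg_step_in)
  qed
  \<comment> \<open>The constant is \<open>6 * \<eta> * \<delta> * D\<close> divided by
    \<open>2 * \<eta>\<close>, with \<open>\<delta> = c * (L * r k / 2)\<close>. The squared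
    distances are kept as a difference so that they telescope.\<close>
  have step: "f (fst (p k), snd u) - f (fst u, snd (p k))
      \<le> ((norm (z k - u))\<^sup>2 - (norm (z (Suc k) - u))\<^sup>2) / (2 * \<eta>) + 3 / 2 * L * c * D * r k" for k
  proof -
    have "2 * \<eta> * inner (saddle_field (g (p k))) (p k - u)
        \<le> (norm (z k - u))\<^sup>2 - (norm (z (Suc k) - u))\<^sup>2 + 6 * \<eta> * (c * (L * r k / 2)) * D"
    proof (rule extragradient_step)
      show "inner (z k - \<eta> *\<^sub>R fd_field f (r k) (z k) - p k) (z (Suc k) - p k) \<le> 0"
        unfolding p_eq by (rule zoceg_step_variational[OF X Y zin])
      show "inner (z k - \<eta> *\<^sub>R fd_field f (r k) (p k) - z (Suc k)) (u - z (Suc k)) \<le> 0"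
        unfolding z_Suc by (rule zoceg_step_variational[OF X Y u])
      show "norm (fd_field f (r k) (z k) - saddle_field (g (z k))) \<le> c * (L * r k / 2)"
        unfolding c_def by (rule fd_field_error[OF q[folded z_def] r d lip])
      show "norm (fd_field f (r k) (p k) - saddle_field (g (p k))) \<le> c * (L * r k / 2)"
        unfolding c_def by (rule fd_field_error[OF qp[folded p_def] r d lip])
      show "norm (saddle_field (g (p k)) - saddle_field (g (z k))) \<le> L * norm (p k - z k)"
        unfolding norm_saddle_field_diff using pin zin W by (intro lip) auto
      show "norm (p k - z (Suc k)) \<le> D" "norm (p k - u) \<le> D"
        unfolding D_def using pin zin u X(1) Y(1) by (auto intro!: norm_diff_le_diameter)
    qed (use \<eta> in auto)
    hence "inner (saddle_field (g (p k))) (p k - u)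
        \<le> ((norm (z k - u))\<^sup>2 - (norm (z (Suc k) - u))\<^sup>2) / (2 * \<eta>) + 3 / 2 * L * c * D * r k"
      using \<eta>(1) by (simp add: field_simps)
    moreover have "f (fst (p k), snd u) - f (fst u, snd (p k))
        \<le> inner (saddle_field (g (p k))) (p k - u)"
      using pin[of k] W by (intro saddle_gap_le_inner[OF cx cy pin u d]) (auto simp: mem_Times_iff)
    ultimately show ?thesis by linarith
  qed
  have "(\<Sum>k<K. f (fst (p k), snd u) - f (fst u, snd (p k)))
      \<le> (\<Sum>k<K. ((norm (z k - u))\<^sup>2 - (norm (z (Suc k) - u))\<^sup>2) / (2 * \<eta>) + 3 / 2 * L * c * D * r k)"
    by (intro sum_mono step)
  also have "\<dots> = ((norm (z 0 - u))\<^sup>2 - (norm (z K - u))\<^sup>2) / (2 * \<eta>)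
      + 3 / 2 * L * c * D * (\<Sum>k<K. r k)"
    by (simp only: sum.distrib sum_distrib_left[symmetric] sum_divide_distrib[symmetric]
        sum_lessThan_telescope'[of "\<lambda>k. (norm (z k - u))\<^sup>2"])
  also have "\<dots> \<le> D\<^sup>2 / (2 * \<eta>) + 3 / 2 * L * c * D * (\<Sum>k<K. r k)"
  proof -
    have "(norm (z 0 - u))\<^sup>2 \<le> D\<^sup>2"
      unfolding D_def using zin u X(1) Y(1) by (intro power_mono norm_diff_le_diameter) auto
    hence "(norm (z 0 - u))\<^sup>2 - (norm (z K - u))\<^sup>2 \<le> D\<^sup>2"
      using zero_le_power2[of "norm (z K - u)"] by linarith
    thus ?thesis using \<eta> by (intro add_right_mono divide_right_mono) auto
  qed
  finally have S: "(\<Sum>k<K. f (fst (p k), snd u) - f (fst u, snd (p k)))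
      \<le> D\<^sup>2 / (2 * \<eta>) + 3 / 2 * L * c * D * (\<Sum>k<K. r k)" .
  have "f (fst zh, snd u) - f (fst u, snd zh)
      \<le> (\<Sum>k<K. f (fst (p k), snd u) - f (fst u, snd (p k))) / real K"
    unfolding zh_def zoceg_avg_def p_def[symmetric]
    using u by (intro average_saddle_gap[OF cx cy pin K]) auto
  also have "\<dots> \<le> (D\<^sup>2 / (2 * \<eta>) + 3 / 2 * L * c * D * (\<Sum>k<K. r k)) / real K"
    using S by (rule divide_right_mono) simp
  also have "\<dots> = (D\<^sup>2 / \<eta> + 3 * L * (c * (\<Sum>k<K. r k)) * D) / (2 * real K)"
    using K \<eta> by (simp add: field_simps)
  finally show ?thesis by (simp add: c_def)
qed

lemma zoceg_avg_in:
  assumes "compact X" "convex X" "compact Y" "convex Y" "z0 \<in> X \<times> Y" "0 < K"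
  shows "zoceg_avg f X Y \<eta> r z0 K \<in> X \<times> Y"
proof -
  have "(\<Sum>k<K. (1 / real K) *\<^sub>R zoceg_plus f X Y \<eta> r z0 k) \<in> X \<times> Y"
    using assms by (intro convex_sum)
      (auto intro: convex_Times simp: zoceg_plus_def simp del: mem_Times_iff
        intro!: zoceg_step_in)
  thus ?thesis by (simp add: zoceg_avg_def scaleR_sum_right)
qed

section \<open>Constraint violation and objective error in the Lagrangian case\<close>

lemma lagrangian_inner: "lagrangian \<phi>\<^sub>0 \<phi> z = \<phi>\<^sub>0 (fst z) + inner (snd z) (\<phi> (fst z))"
  by (simp add: lagrangian_def inner_vec_def)

text \<open>Negative components of \<open>v\<close> meet zeros. Thus the normalized positive part is
  a direction that detects exactly the size of the violation.\<close>

lemma inner_pos_part: "inner (pos_part v) v = (norm (pos_part v))\<^sup>2"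
  unfolding power2_norm_eq_inner inner_vec_def
  by (intro sum.cong) (auto simp: pos_part_def max_def)

text \<open>The multiplier of the saddle point is interior to \<open>Y\<close>, so the affine function it maximises
  has zero slope; all the constraints are thus active.\<close>

lemma saddle_constraints_active:
  assumes s: "is_saddle_point (lagrangian \<phi>\<^sub>0 \<phi>) X Y zs" and R: "is_max_radius Y (snd zs) R"
  shows "\<phi> (fst zs) = 0"
proof (rule ccontr)
  assume n: "\<phi> (fst zs) \<noteq> 0"
  \<comment> \<open>Moving the multiplier by \<open>R\<close> in this direction would raise the
    Lagrangian by \<open>R\<close> times the norm of the constraint vector.\<close>
  define v where "v = (1 / norm (\<phi> (fst zs))) *\<^sub>R \<phi> (fst zs)"
  have "norm v = 1" using n by (simp add: v_def)
  with R have "snd zs + R *\<^sub>R v \<in> Y" and R0: "0 < R"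
    by (auto simp: is_max_radius_def is_arg_max_def)
  with s have "lagrangian \<phi>\<^sub>0 \<phi> (fst zs, snd zs + R *\<^sub>R v) \<le> lagrangian \<phi>\<^sub>0 \<phi> zs"
    by (auto simp: is_saddle_point_def mem_Times_iff)
  hence "R * norm (\<phi> (fst zs)) \<le> 0"
    using n by (simp add: lagrangian_inner inner_add_left v_def dot_square_norm power2_eq_square)
  with R0 n show False by (simp add: mult_le_0_iff)
qed

text \<open>Since the constraint vector vanishes at \<open>fst zs\<close>, the Lagrangian there
  equals the optimal objective whatever \<open>y\<close> is. The gap hypothesis thus bounds the
  Lagrangian at \<open>x\<close> for each multiplier \<open>v\<close> in \<open>Y\<close>. The
  objective bound is the case \<open>v = 0\<close>, hence its premise
  \<open>0 \<in> Y\<close>.\<close>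

lemma lagrangian_gap_bounds:
  assumes s: "is_saddle_point (lagrangian \<phi>\<^sub>0 \<phi>) X Y zs" and R: "is_max_radius Y (snd zs) R"
    and x: "x \<in> X"
    and gap: "\<And>v. v \<in> Y \<Longrightarrow>
      lagrangian \<phi>\<^sub>0 \<phi> (x, v) - lagrangian \<phi>\<^sub>0 \<phi> (fst zs, y) \<le> \<epsilon>"
    and \<epsilon>: "0 \<le> \<epsilon>"
  shows "norm (pos_part (\<phi> x)) \<le> \<epsilon> / R"
    and "0 \<in> Y \<Longrightarrow> \<phi>\<^sub>0 x - \<phi>\<^sub>0 (fst zs) \<le> \<epsilon>"
proof -
  note act = saddle_constraints_active[OF s R]
  have R0: "0 < R" and RY: "\<And>u. norm u = 1 \<Longrightarrow> snd zs + R *\<^sub>R u \<in> Y"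
    using R by (auto simp: is_max_radius_def is_arg_max_def)
  show "\<phi>\<^sub>0 x - \<phi>\<^sub>0 (fst zs) \<le> \<epsilon>" if "0 \<in> Y"
    using gap[OF that] act by (simp add: lagrangian_inner)
  show "norm (pos_part (\<phi> x)) \<le> \<epsilon> / R"
  proof (cases "pos_part (\<phi> x) = 0")
    case True thus ?thesis using \<epsilon> R0 by simp
  next
    case False
    \<comment> \<open>Testing with \<open>snd zs + R *\<^sub>R u\<close> makes the violation appear
      with factor \<open>R\<close>.\<close>
    define u where "u = (1 / norm (pos_part (\<phi> x))) *\<^sub>R pos_part (\<phi> x)"
    have nu: "norm u = 1" using False by (simp add: u_def)
    have "inner u (\<phi> x) = norm (pos_part (\<phi> x))"
      using False by (simp add: u_def inner_pos_part power2_eq_square)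
    hence "\<phi>\<^sub>0 x + inner (snd zs) (\<phi> x) + R * norm (pos_part (\<phi> x)) - \<phi>\<^sub>0 (fst zs) \<le> \<epsilon>"
      using gap[OF RY[OF nu]] act by (simp add: lagrangian_inner inner_add_left)
    moreover have "\<phi>\<^sub>0 (fst zs) \<le> \<phi>\<^sub>0 x + inner (snd zs) (\<phi> x)"
      using s x act unfolding is_saddle_point_def
      by (auto simp: lagrangian_inner mem_Times_iff)
    ultimately show ?thesis using R0 by (simp add: le_divide_eq mult.commute)
  qed
qed

section \<open>The iteration count for accuracy \<open>\<epsilon>\<close>\<close>

theorem corollary2:
  fixes f :: "(real ^ 'n) \<times> (real ^ 'm) \<Rightarrow> real"
    and X :: "(real ^ 'n) set" and Y :: "(real ^ 'm) set"
    and W :: "((real ^ 'n) \<times> (real ^ 'm)) set"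
    and grad :: "(real ^ 'n) \<times> (real ^ 'm) \<Rightarrow> (real ^ 'n) \<times> (real ^ 'm)"
    and zs z0 :: "(real ^ 'n) \<times> (real ^ 'm)"
    and G L \<eta> M\<^sub>3 \<epsilon> :: real and r :: "nat \<Rightarrow> real" and K :: nat
  assumes "compact X" and "convex X" and "compact Y" and "convex Y"
    and "\<forall>y\<in>Y. convex_on X (\<lambda>x. f (x, y))"
    and "\<forall>x\<in>X. concave_on Y (\<lambda>y. f (x, y))"
    and "\<forall>z1\<in>X \<times> Y. \<forall>z2\<in>X \<times> Y. \<bar>f z1 - f z2\<bar> \<le> G * norm (z1 - z2)"
    and "X \<times> Y \<subseteq> W"
    and "\<forall>z\<in>W. GDERIV f z :> grad z" and "continuous_on W grad"
    and "\<forall>z1\<in>W. \<forall>z2\<in>W. norm (grad z1 - grad z2) \<le> L * norm (z1 - z2)"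
    and "is_saddle_point f X Y zs"
    and "0 < \<eta> * L" and "\<eta> * L \<le> 1 / 2"
    and "\<forall>k. r k > 0" and "summable r" and "M\<^sub>3 > 0"
    and "(\<Sum>k. r k) \<le> M\<^sub>3 / (sqrt CARD('n) + sqrt CARD('m))"
    and "z0 \<in> X \<times> Y"
    and "\<forall>k. query_segments (r k) (zoceg f X Y \<eta> r z0 k) \<subseteq> W"
    and "\<forall>k. query_segments (r k) (zoceg_plus f X Y \<eta> r z0 k) \<subseteq> W"
    and "\<epsilon> > 0" and "K > 1"
    and "real K \<ge> max ((diameter (X \<times> Y))\<^sup>2 / (\<eta> * \<epsilon>)) (3 * L * M\<^sub>3 * diameter (X \<times> Y) / \<epsilon>)"
  shows "duality_gap f zs (zoceg_avg f X Y \<eta> r z0 K) \<le> \<epsilon> \<and>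
    (\<forall>\<phi>\<^sub>0 \<phi> R.
       f = lagrangian \<phi>\<^sub>0 \<phi> \<and>
       convex_on UNIV \<phi>\<^sub>0 \<and> (\<forall>j. convex_on UNIV (\<lambda>x. \<phi> x $ j)) \<and>
       is_arg_min \<phi>\<^sub>0 (\<lambda>x. x \<in> X \<and> (\<forall>j. \<phi> x $ j \<le> 0)) (fst zs) \<and>
       is_max_radius Y (snd zs) R \<longrightarrow>
         norm (pos_part (\<phi> (fst (zoceg_avg f X Y \<eta> r z0 K)))) \<le> \<epsilon> / R \<and>
         (0 \<in> Y \<longrightarrow> \<phi>\<^sub>0 (fst (zoceg_avg f X Y \<eta> r z0 K)) - \<phi>\<^sub>0 (fst zs) \<le> \<epsilon>))"
proof -
  let ?zh = "zoceg_avg f X Y \<eta> r z0 K"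
  define D where "D = diameter (X \<times> Y)"
  define c where "c = sqrt CARD('n) + sqrt CARD('m)"
  have c: "0 < c" by (simp add: c_def add_pos_pos)
  have D: "0 \<le> D"
    unfolding D_def using assms(1,3) by (intro diameter_ge_0 compact_imp_bounded compact_Times)
  \<comment> \<open>Positivity of \<open>\<eta> * L\<close> alone would allow both factors to be
    negative. As \<open>r 0\<close> is positive, the first query segments give two distinct points
    of \<open>W\<close>, where the Lipschitz bound forces \<open>0 \<le> L\<close>; any axis
    direction will do.\<close>
  have L: "0 < L"
  proof -
    let ?w = "(fst z0 + r 0 *\<^sub>R axis undefined 1, snd z0)"
    have "?w \<in> query_segments (r 0) z0" "z0 \<in> query_segments (r 0) z0"
      by (auto simp: query_segments_def)
    moreover have "query_segments (r 0) z0 \<subseteq> W"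
      using assms(20)[rule_format, of 0] by simp
    ultimately have "0 \<le> L * norm (?w - z0)"
      using assms(11) order_trans[OF norm_ge_zero] by blast
    moreover have "?w - z0 \<noteq> 0"
      using assms(15)[rule_format, of 0] by (auto simp: prod_eq_iff axis_eq_0_iff)
    ultimately have "0 \<le> L" by (simp add: zero_le_mult_iff)
    with assms(13) show ?thesis by (cases "L = 0") auto
  qed
  with assms(13) have \<eta>: "0 < \<eta>" by (simp add: zero_less_mult_iff)
  have "(\<Sum>k<K. r k) \<le> (\<Sum>k. r k)"
    using assms(15,16) by (intro sum_le_suminf) (auto intro: less_imp_le)
  with assms(18) have "(\<Sum>k<K. r k) \<le> M\<^sub>3 / c" by (simp add: c_def)
  hence rM: "c * (\<Sum>k<K. r k) \<le> M\<^sub>3" using c by (simp add: le_divide_eq mult.commute)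
  have gap: "f (fst ?zh, snd u) - f (fst u, snd ?zh) \<le> \<epsilon>" if u: "u \<in> X \<times> Y" for u
  proof -
    have "f (fst ?zh, snd u) - f (fst u, snd ?zh)
        \<le> (D\<^sup>2 / \<eta> + 3 * L * (c * (\<Sum>k<K. r k)) * D) / (2 * real K)"
      unfolding D_def c_def
      by (rule zoceg_avg_gap[where W = W and g = grad]) (use assms u L \<eta> in auto)
    also have "\<dots> \<le> (D\<^sup>2 / \<eta> + 3 * L * M\<^sub>3 * D) / (2 * real K)"
      using rM L D by (intro divide_right_mono add_left_mono mult_right_mono mult_left_mono) auto
    \<comment> \<open>Each of the two lower bounds on \<open>K\<close> controls one summand of the
      numerator by \<open>real K * \<epsilon>\<close>; the 2 in the denominator makes the total
      exactly \<open>\<epsilon>\<close>.\<close>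
    also have "\<dots> \<le> (real K * \<epsilon> + real K * \<epsilon>) / (2 * real K)"
    proof (intro divide_right_mono add_mono)
      have "D\<^sup>2 / (\<eta> * \<epsilon>) \<le> real K" "3 * L * M\<^sub>3 * D / \<epsilon> \<le> real K"
        using assms(24) by (simp_all add: D_def)
      thus "D\<^sup>2 / \<eta> \<le> real K * \<epsilon>" "3 * L * M\<^sub>3 * D \<le> real K * \<epsilon>"
        using \<eta> assms(22) by (simp_all add: field_simps)
    qed simp
    also have "\<dots> = \<epsilon>" using assms(23) by simp
    finally show ?thesis .
  qed
  have zs: "fst zs \<in> X" "snd zs \<in> Y"
    using assms(12) by (auto simp: is_saddle_point_def)
  have zh: "fst ?zh \<in> X"
    using zoceg_avg_in[OF assms(1-4,19), of K] assms(23) by (auto simp: mem_Times_iff)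
  show ?thesis
  proof (intro conjI allI impI; (elim conjE)?)
    show "duality_gap f zs ?zh \<le> \<epsilon>"
      using gap[of zs] zs by (simp add: duality_gap_def mem_Times_iff)
    fix \<phi>\<^sub>0 \<phi> R
    assume f: "f = lagrangian \<phi>\<^sub>0 \<phi>" and R: "is_max_radius Y (snd zs) R"
    have s: "is_saddle_point (lagrangian \<phi>\<^sub>0 \<phi>) X Y zs"
      using assms(12) f by simp
    \<comment> \<open>The comparison points pair the optimal \<open>fst zs\<close> with every
      multiplier in \<open>Y\<close>.\<close>
    have "lagrangian \<phi>\<^sub>0 \<phi> (fst ?zh, v) - lagrangian \<phi>\<^sub>0 \<phi> (fst zs, snd ?zh) \<le> \<epsilon>" if "v \<in> Y" for v
      using gap[of "(fst zs, v)"] that zs f by simp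
    note bounds = lagrangian_gap_bounds[OF s R zh this]
    show "norm (pos_part (\<phi> (fst ?zh))) \<le> \<epsilon> / R"
      using bounds(1) assms(22) by simp
    show "\<phi>\<^sub>0 (fst ?zh) - \<phi>\<^sub>0 (fst zs) \<le> \<epsilon>" if "0 \<in> Y"
      using bounds(2) assms(22) that by simp
  qed
qed

end
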